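(* Let $\mathbf{s}=(s_k)_{k\ge 0}$ be a sequence of real numbers and let $E\mathbf{s}=(s_1,s_2,s_3,\dots)$. Let $m\ge 0$ be an integer and put $\varepsilon_m=(-1)^{\binom{m+1}{2}}$. Then for the Hankel determinants $D_{p,n}(\mathbf{t})=\det\big(a_{p+i+j}(\mathbf{t})\big)_{i,j=0}^{n-1}$ (defined in the context) we have $$D_{-m,0}(\mathbf{s})=1,\qquad D_{-m,n}(\mathbf{s})=0 \text{ for } 0<n\le m,\qquad D_{-m,n+m+1}(\mathbf{s})=\varepsilon_m\, D_{m,n}(E\mathbf{s}) \text{ for all integers } n\ge 0.$$ Equivalently, the sequence $(D_{-m,n}(\mathbf{s}))_{n\ge0}$ equals $(u_n)_{n\ge 0}$ where $u_0=1$, $u_n=0$ for $0<n<m+1$, and $u_{m+1+i}=(-1)^{\binom{m+1}{2}}D_{m,i}(E\mathbf{s})$ for $i\ge 0$.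
   Context: For a real sequence $\mathbf{t}=(t_k)_{k\ge0}$ define numbers $a_{n,k}(\mathbf{t})$ for integers $n,k$ by $a_{0,k}(\mathbf{t})=[k=0]$, $a_{n,k}(\mathbf{t})=0$ for $k<0$, and for $n\ge 1$, $k\ge0$: $a_{n,k}(\mathbf{t})=a_{n-1,k-1}(\mathbf{t})+t_k\,a_{n-1,k}(\mathbf{t})+a_{n-1,k+1}(\mathbf{t})$. Further set $a_{n,k}(\mathbf{t})=0$ for $n<0$. Write $a_n(\mathbf{t})=a_{n,0}(\mathbf{t})$ (so $a_0=1$, $a_1=t_0$, $a_2=t_0^2+1$, $a_n=0$ for $n<0$). For an integer $p$ (possibly negative) and $n\ge 0$, $D_{p,n}(\mathbf{t})=\det\big(a_{p+i+j}(\mathbf{t})\big)_{i,j=0}^{n-1}$, with the determinant of the empty ($n=0$) matrix equal to $1$. *)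

theory Defs
  imports Complex_Main "Jordan_Normal_Form.Determinant"
begin

(* The numbers a_{n,k}(t) for n \<ge> 0 and integer k. *)
fun path_wt :: "(nat \<Rightarrow> real) \<Rightarrow> nat \<Rightarrow> int \<Rightarrow> real" where
  "path_wt t 0 k = (if k = 0 then 1 else 0)"
| "path_wt t (Suc n) k =
    (if k < 0 then 0
     else path_wt t n (k - 1) + t (nat k) * path_wt t n k + path_wt t n (k + 1))"

(* The extension of a_{n,k}(t) to all integers n, by zero for n < 0. *)
definition a_coeff :: "(nat \<Rightarrow> real) \<Rightarrow> int \<Rightarrow> int \<Rightarrow> real" where
  "a_coeff t n k = (if n < 0 then 0 else path_wt t (nat n) k)"

definition a_seq :: "(nat \<Rightarrow> real) \<Rightarrow> int \<Rightarrow> real" where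
  "a_seq t n = a_coeff t n 0"

(* For n = 0 this is the determinant of the empty matrix, which is 1. *)
definition hankel_det :: "int \<Rightarrow> nat \<Rightarrow> (nat \<Rightarrow> real) \<Rightarrow> real" where
  "hankel_det p n t = det (mat n n (\<lambda>(i, j). a_seq t (p + int i + int j)))"

definition shift :: "(nat \<Rightarrow> real) \<Rightarrow> nat \<Rightarrow> real" where
  "shift s k = s (Suc k)"

definition eps :: "nat \<Rightarrow> real" where
  "eps m = (- 1) ^ ((m + 1) choose 2)"

lemma a_coeff_recurrence:
  assumes "n \<ge> 1" and "k \<ge> 0"
  shows "a_coeff t n k =
    a_coeff t (n - 1) (k - 1) + t (nat k) * a_coeff t (n - 1) k + a_coeff t (n - 1) (k + 1)"
proof -
  have "nat n = Suc (nat (n - 1))"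
    using assms(1) by simp
  then show ?thesis
    using assms by (simp add: a_coeff_def)
qed

lemma a_coeff_boundary:
  "a_coeff t 0 k = (if k = 0 then 1 else 0)"
  "k < 0 \<Longrightarrow> a_coeff t n k = 0"
  "n < 0 \<Longrightarrow> a_coeff t n k = 0"
  by (cases "nat n"; simp add: a_coeff_def)+

lemma hankel_det_0: "hankel_det p 0 t = 1"
  by (simp add: hankel_det_def)

end

theory Submission imports Defs
begin

text \<open>
  Let \<open>A\<close> and \<open>B\<close> be the generating functions of the sequences \<open>a_n\<close> for \<open>s\<close> and for \<open>Es\<close>.
  Decomposing paths at their visits to height \<open>0\<close> gives \<open>A = 1 + s_0 x A + x\<^sup>2 A B\<close>, so
  \<open>1/A = 1 - s_0 x - x\<^sup>2 B\<close>; let \<open>c_n\<close> be its coefficients. Multiplying the Hankel matrix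
  \<open>(a_{i+j-m})\<close> of size \<open>n + m + 1\<close> from the left by the unitriangular Toeplitz matrix
  \<open>(c_{i-j})\<close> makes it block upper triangular: the upper left block is the exchange matrix of
  size \<open>m + 1\<close>, and the lower right block is \<open>(- c_{m+2+i+j}) = (a_{m+i+j}(Es))\<close> times the
  unitriangular Toeplitz matrix \<open>(a_{j-i})\<close>.
\<close>

section \<open>Hankel determinants of reciprocal power series\<close>

text \<open>Expanding along the first column leaves only its bottom entry, with sign
  \<open>(- 1) ^ Suc m\<close>; these exponents add up to a triangular number.\<close>

lemma det_exchange_mat:
  "det (mat (Suc m) (Suc m) (\<lambda>(i, j). if i + j = m then 1 else 0))
     = ((- 1) ^ (Suc m choose 2) :: 'a :: comm_ring_1)"
proof (induction m)
  case 0
  then show ?case by (simp add: det_single numeral_2_eq_2)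
next
  case (Suc m)
  let ?J = "\<lambda>m. mat (Suc m) (Suc m) (\<lambda>(i, j). if i + j = m then 1 else 0 :: 'a)"
  have del: "mat_delete (?J (Suc m)) (Suc m) 0 = ?J m"
    by (rule eq_matI) (auto simp: mat_delete_def)
  have "det (?J (Suc m))
      = (\<Sum>i<Suc (Suc m). ?J (Suc m) $$ (i, 0) * cofactor (?J (Suc m)) i 0)"
    by (rule laplace_expansion_column[of _ "Suc (Suc m)"]) auto
  also have "\<dots> = (\<Sum>i<Suc (Suc m). if i = Suc m then cofactor (?J (Suc m)) i 0 else 0)"
    by (rule sum.cong) auto
  also have "\<dots> = (- 1) ^ Suc m * det (?J m)"
    by (simp add: cofactor_def del)
  also have "\<dots> = (- 1) ^ (Suc m + (Suc m choose 2))"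
    by (simp only: Suc.IH power_add)
  also have "Suc m + (Suc m choose 2) = Suc (Suc m) choose 2"
    by (simp add: numeral_2_eq_2)
  finally show ?case .
qed

lemma prod_list_diag_mat_1:
  assumes "\<And>i. i < n \<Longrightarrow> f (i, i) = 1"
  shows "prod_list (diag_mat (mat n n f)) = (1 :: 'a :: comm_monoid_mult)"
  using assms by (simp add: prod_list_diag_prod)

lemma det_hankel_reciprocal:
  fixes a c :: "nat \<Rightarrow> 'a :: idom"
  assumes c0: "c 0 = 1"
    and inv: "\<And>n. (\<Sum>k\<le>n. c (n - k) * a k) = (if n = 0 then 1 else 0)"
  shows "det (mat (n + m + 1) (n + m + 1) (\<lambda>(i, j). if i + j < m then 0 else a (i + j - m)))
       = (- 1) ^ (Suc m choose 2) * det (mat n n (\<lambda>(i, j). - c (m + 2 + i + j)))"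
proof -
  define N where "N = Suc m + n"
  \<comment> \<open>Coefficients of \<open>x^m\<close> times the series of \<open>a\<close>, so that
    all entries of \<open>H\<close> have one uniform form.\<close>
  define h where "h t = (if t < m then 0 else a (t - m))" for t
  define C where "C = mat N N (\<lambda>(i, j). if j \<le> i then c (i - j) else 0)"
  define H where "H = mat N N (\<lambda>(i, j). h (i + j))"
  define X where "X = mat (Suc m) (Suc m) (\<lambda>(i, j). if i + j = m then 1 else 0 :: 'a)"
  \<comment> \<open>Read off from the product itself: a block triangular determinant sees only the
    diagonal blocks.\<close>
  define Y where "Y = mat (Suc m) n (\<lambda>(i, j). (C * H) $$ (i, Suc m + j))"
  define K where "K = mat n n (\<lambda>(i, j). - c (m + 2 + i + j))"
  define U where "U = mat n n (\<lambda>(i, j). if i \<le> j then a (j - i) else 0)"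
  have a0: "a 0 = 1"
    using inv[of 0] c0 by simp
  have CH: "(C * H) $$ (i, j) = (\<Sum>k\<le>i. c (i - k) * h (k + j))" if "i < N" "j < N" for i j
  proof -
    have "(C * H) $$ (i, j) = (\<Sum>k\<in>{0..<N}. (if k \<le> i then c (i - k) else 0) * h (k + j))"
      using that by (simp add: C_def H_def scalar_prod_def)
    also have "\<dots> = (\<Sum>k\<le>i. c (i - k) * h (k + j))"
      using that by (intro sum.mono_neutral_cong_right) auto
    finally show ?thesis .
  qed
  have left: "(C * H) $$ (i, j) = (if i + j = m then 1 else 0)" if "i < N" "j \<le> m" for i j
  proof -
    have "(C * H) $$ (i, j) = (\<Sum>k\<le>i. c (i - k) * h (k + j))"
      using that by (intro CH) (auto simp: N_def)
    also have "\<dots> = (if i + j = m then 1 else 0)"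
    proof (cases "i + j < m")
      case True
      then show ?thesis by (simp add: h_def)
    next
      case False
      \<comment> \<open>Since j \<le> m, the nonzero part of \<open>h\<close> starts at k = m - j
        within the range, so the convolution with \<open>c\<close> is complete and
        \<open>inv\<close> evaluates it.\<close>
      have "(\<Sum>k\<le>i. c (i - k) * h (k + j)) = (\<Sum>k\<in>{m - j..i}. c (i - k) * h (k + j))"
        by (rule sum.mono_neutral_right) (auto simp: h_def)
      also have "\<dots> = (\<Sum>r\<le>i + j - m. c (i + j - m - r) * a r)"
        by (rule sum.reindex_bij_witness[of _ "\<lambda>r. r + m - j" "\<lambda>k. k + j - m"])
          (use False that in \<open>auto simp: h_def\<close>)
      also have "\<dots> = (if i + j = m then 1 else 0)"
        using False by (simp only: inv) auto
      finally show ?thesis .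
    qed
    finally show ?thesis .
  qed
  have right: "(C * H) $$ (Suc m + i, Suc m + j) = (K * U) $$ (i, j)" if "i < n" "j < n" for i j
  proof -
    \<comment> \<open>In these columns the entries start at \<open>a (Suc j)\<close>, so the
      convolution of total index \<open>?n\<close> lacks its terms r \<le> j. As \<open>?n\<close>
      is positive the full sum vanishes, leaving minus the missing terms.\<close>
    let ?n = "Suc m + i + Suc j"
    have "(C * H) $$ (Suc m + i, Suc m + j)
        = (\<Sum>k\<le>Suc m + i. c (Suc m + i - k) * a (k + Suc j))"
      using that by (subst CH) (auto simp: N_def h_def)
    also have "\<dots> = (\<Sum>r\<in>{Suc j..?n}. c (?n - r) * a r)"
      by (rule sum.reindex_bij_witness[of _ "\<lambda>r. r - Suc j" "\<lambda>k. k + Suc j"]) auto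
    also have "\<dots> = - (\<Sum>r\<le>j. c (?n - r) * a r)"
    proof -
      have "{..?n} = {..j} \<union> {Suc j..?n}" by auto
      then have "(\<Sum>r\<le>?n. c (?n - r) * a r)
          = (\<Sum>r\<le>j. c (?n - r) * a r) + (\<Sum>r\<in>{Suc j..?n}. c (?n - r) * a r)"
        by (simp only:) (rule sum.union_disjoint; auto)
      then show ?thesis
        by (simp only: inv) (simp add: eq_neg_iff_add_eq_0 add.commute)
    qed
    also have "\<dots> = (\<Sum>t\<le>j. - c (m + 2 + i + t) * a (j - t))"
      unfolding sum_negf[symmetric]
      by (rule sum.reindex_bij_witness[of _ "\<lambda>t. j - t" "\<lambda>t. j - t"]) (auto simp: Suc_diff_le)
    also have "\<dots> = (\<Sum>t\<in>{0..<n}. - c (m + 2 + i + t) * (if t \<le> j then a (j - t) else 0))"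
      using that by (intro sum.mono_neutral_cong_left) auto
    also have "\<dots> = (K * U) $$ (i, j)"
      using that by (simp add: K_def U_def scalar_prod_def)
    finally show ?thesis .
  qed
  have blocks: "C * H = four_block_mat X Y (0\<^sub>m n (Suc m)) (K * U)"
  proof (rule eq_matI)
    fix i j assume "i < dim_row (four_block_mat X Y (0\<^sub>m n (Suc m)) (K * U))"
      and "j < dim_col (four_block_mat X Y (0\<^sub>m n (Suc m)) (K * U))"
    then have ij: "i < N" "j < N"
      by (auto simp: X_def K_def U_def N_def)
    show "(C * H) $$ (i, j) = four_block_mat X Y (0\<^sub>m n (Suc m)) (K * U) $$ (i, j)"
    proof (cases "j \<le> m")
      case True
      then show ?thesis
        using ij by (auto simp: left X_def Y_def K_def U_def N_def simp del: index_mult_mat(1))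
    next
      case False
      then show ?thesis
        using ij right[of "i - Suc m" "j - Suc m"]
        by (auto simp: X_def Y_def K_def U_def N_def simp del: index_mult_mat(1))
    qed
  qed (auto simp: C_def H_def X_def K_def U_def N_def)
  have carr: "C \<in> carrier_mat N N" "H \<in> carrier_mat N N" "K \<in> carrier_mat n n"
    "U \<in> carrier_mat n n"
    by (auto simp: C_def H_def K_def U_def)
  have "det C = 1"
    using c0 by (subst det_lower_triangular[OF _ carr(1)])
      (auto simp: C_def intro!: prod_list_diag_mat_1)
  moreover have "det U = 1"
    using a0 by (subst det_upper_triangular[OF _ carr(4)])
      (auto simp: U_def intro!: prod_list_diag_mat_1)
  moreover have "det (C * H) = det X * det (K * U)"
    unfolding blocks using carr
    by (intro det_four_block_mat_lower_left_zero) (auto simp: X_def Y_def)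
  ultimately have "det H = (- 1) ^ (Suc m choose 2) * det K"
    using carr by (simp add: det_mult X_def det_exchange_mat)
  then show ?thesis
    by (simp add: H_def h_def K_def N_def add_ac)
qed

section \<open>The continued fraction of the path numbers\<close>

lemma path_wt_neg: "k < 0 \<Longrightarrow> path_wt t n k = 0"
  by (cases n) auto

text \<open>Decomposition of a path at its last visit to height \<open>0\<close>.\<close>

lemma path_wt_Suc_height:
  "path_wt s n (int k + 1)
     = (\<Sum>j<n. path_wt (shift s) j (int k) * path_wt s (n - Suc j) 0)"
proof (induction n arbitrary: k)
  case 0
  then show ?case by simp
next
  case (Suc n)
  \<comment> \<open>The height ranges over the integers here, so that \<open>F (- 1)\<close>, which
    is 0, covers the step from below at k = 0.\<close>
  define F where "F k = (\<Sum>j<n. path_wt (shift s) j k * path_wt s (n - Suc j) 0)" for k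
  have IH: "path_wt s n (int k + 1) = F (int k)" for k
    unfolding F_def by (rule Suc.IH)
  have up: "path_wt s n (int k) = (if k = 0 then path_wt s n 0 else 0) + F (int k - 1)"
  proof (cases k)
    case 0
    then show ?thesis by (simp add: F_def path_wt_neg)
  next
    case (Suc l)
    then show ?thesis using IH[of l] by (simp add: add.commute)
  qed
  have down: "path_wt s n (int k + 2) = F (int k + 1)"
    using IH[of "Suc k"] by (simp add: algebra_simps)
  \<comment> \<open>The split-off summand j = 0 is the case of a path whose final step leaves height
    0; it matches the extra term in \<open>up\<close>.\<close>
  have "(\<Sum>j<Suc n. path_wt (shift s) j (int k) * path_wt s (Suc n - Suc j) 0)
      = (if k = 0 then path_wt s n 0 else 0)
        + (\<Sum>j<n. path_wt (shift s) (Suc j) (int k) * path_wt s (n - Suc j) 0)"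
    by (subst sum.lessThan_Suc_shift) simp
  also have "(\<Sum>j<n. path_wt (shift s) (Suc j) (int k) * path_wt s (n - Suc j) 0)
      = F (int k - 1) + s (Suc k) * F (int k) + F (int k + 1)"
    by (simp add: F_def shift_def sum.distrib sum_distrib_left algebra_simps)
  finally show ?case
    using up down IH[of k] by (simp add: nat_add_distrib add_ac)
qed

text \<open>Here \<open>c\<close> lists the coefficients of \<open>1 - s_0 x - x^2 B\<close>; the
  identity is the step recurrence at height 0 with the height-1 term expanded by the last-visit
  decomposition.\<close>

lemma path_wt_reciprocal:
  fixes s :: "nat \<Rightarrow> real"
  defines "c \<equiv> \<lambda>k. if k = 0 then 1 else if k = 1 then - s 0
                    else - path_wt (shift s) (k - 2) 0"
  shows "(\<Sum>k\<le>n. c (n - k) * path_wt s k 0) = (if n = 0 then 1 else 0)"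
proof (cases n)
  case 0
  then show ?thesis by (simp add: c_def)
next
  case (Suc l)
  have "(\<Sum>k\<le>n. c (n - k) * path_wt s k 0)
      = (\<Sum>k<l. c (n - k) * path_wt s k 0) - s 0 * path_wt s l 0 + path_wt s n 0"
    by (simp add: Suc c_def lessThan_Suc_atMost[symmetric])
  \<comment> \<open>For k < l the index n - k is at least 2, and j = l - 1 - k equals n - k -
    2.\<close>
  also have "(\<Sum>k<l. c (n - k) * path_wt s k 0)
      = - (\<Sum>j<l. path_wt (shift s) j 0 * path_wt s (l - Suc j) 0)"
    unfolding sum_negf[symmetric]
    by (rule sum.reindex_bij_witness[of _ "\<lambda>j. l - Suc j" "\<lambda>j. l - Suc j"])
      (auto simp: Suc c_def)
  also have "\<dots> = - path_wt s l 1"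
    using path_wt_Suc_height[of s l 0] by simp
  also have "\<dots> - s 0 * path_wt s l 0 + path_wt s n 0 = 0"
    by (simp add: Suc path_wt_neg)
  finally show ?thesis by (simp add: Suc)
qed

section \<open>Negatively shifted Hankel determinants\<close>

lemma a_seq_int: "a_seq t (int n) = path_wt t n 0"
  by (simp add: a_seq_def a_coeff_def)

lemma a_seq_neg: "n < 0 \<Longrightarrow> a_seq t n = 0"
  by (simp add: a_seq_def a_coeff_def)

lemma hankel_det_neg_eq_0:
  assumes "0 < n" "n \<le> m"
  shows "hankel_det (- int m) n s = 0"
proof -
  define A where "A = mat n n (\<lambda>(i, j). a_seq s (- int m + int i + int j))"
  have "det A = (\<Sum>j<n. A $$ (0, j) * cofactor A 0 j)"
    using assms by (intro laplace_expansion_row) (auto simp: A_def)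
  \<comment> \<open>The top row has indices -m, ..., n - 1 - m, all negative because n \<le>
    m.\<close>
  also have "\<dots> = 0"
    using assms by (intro sum.neutral) (auto simp: A_def a_seq_neg)
  finally show ?thesis
    by (simp add: hankel_det_def A_def)
qed

lemma hankel_det_neg_shift:
  "hankel_det (- int m) (n + m + 1) s = eps m * hankel_det (int m) n (shift s)"
proof -
  define c where "c = (\<lambda>k. if k = 0 then 1 else if k = 1 then - s 0
                    else - path_wt (shift s) (k - 2) 0)"
  have "mat (n + m + 1) (n + m + 1) (\<lambda>(i, j). a_seq s (- int m + int i + int j))
      = mat (n + m + 1) (n + m + 1)
          (\<lambda>(i, j). if i + j < m then 0 else path_wt s (i + j - m) 0)"
  proof (rule cong_mat[OF refl refl], clarsimp, intro conjI impI)
    fix i j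
    show "a_seq s (int i - int m + int j) = 0" if "i + j < m"
      using that by (intro a_seq_neg) simp
    show "a_seq s (int i - int m + int j) = path_wt s (i + j - m) 0" if "\<not> i + j < m"
      using that a_seq_int[of s "i + j - m"] by (simp add: of_nat_diff algebra_simps)
  qed
  \<comment> \<open>The offset 2 puts every index into the last branch of \<open>c\<close>,
    cancelling both the shift by 2 and the sign.\<close>
  moreover have "mat n n (\<lambda>(i, j). a_seq (shift s) (int m + int i + int j))
      = mat n n (\<lambda>(i, j). - c (m + 2 + i + j))"
  proof (rule cong_mat[OF refl refl], clarsimp)
    fix i j
    show "a_seq (shift s) (int m + int i + int j) = - c (Suc (Suc (m + i + j)))"
      using a_seq_int[of "shift s" "m + i + j"] by (simp add: c_def)
  qed
  moreover have "c 0 = 1" "(\<Sum>k\<le>n. c (n - k) * path_wt s k 0) = (if n = 0 then 1 else 0)" for n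
    unfolding c_def by (simp, rule path_wt_reciprocal)
  ultimately show ?thesis
    using det_hankel_reciprocal[of c "\<lambda>k. path_wt s k 0" n m]
    by (simp add: hankel_det_def eps_def)
qed

theorem theorem1:
  fixes s :: "nat \<Rightarrow> real" and m :: nat
  shows "hankel_det (- int m) 0 s = 1
    \<and> (\<forall>n. 0 < n \<and> n \<le> m \<longrightarrow> hankel_det (- int m) n s = 0)
    \<and> (\<forall>n. hankel_det (- int m) (n + m + 1) s = eps m * hankel_det (int m) n (shift s))
    \<and> (\<exists>u :: nat \<Rightarrow> real. u 0 = 1
        \<and> (\<forall>n. 0 < n \<and> n < m + 1 \<longrightarrow> u n = 0)
        \<and> (\<forall>i. u (m + 1 + i) = (- 1) ^ ((m + 1) choose 2) * hankel_det (int m) i (shift s))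
        \<and> (\<forall>n. hankel_det (- int m) n s = u n))"
\<comment> \<open>The determinant sequence itself is the witness for \<open>u\<close>.\<close>
proof (intro conjI exI[of _ "\<lambda>n. hankel_det (- int m) n s"] allI impI)
  fix n
  show "hankel_det (- int m) (n + m + 1) s = eps m * hankel_det (int m) n (shift s)"
    by (rule hankel_det_neg_shift)
  then show "hankel_det (- int m) (m + 1 + n) s
      = (- 1) ^ ((m + 1) choose 2) * hankel_det (int m) n (shift s)"
    by (simp add: eps_def add_ac)
qed (simp_all add: hankel_det_0 hankel_det_neg_eq_0)

end
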